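(* For any subflag simplicial complex $\Delta$, the following are equivalent: (a) $\Delta$ is skeleton-E-chordal; (b) $\Delta$ is skeleton-clique-chordal; (c) $\Delta$ splits as $\Delta=\Delta_1\cup\Delta_2$, where each $\Delta_i$ is a skeleton-E-chordal induced subcomplex of $\Delta$, and $\Delta_1\cap\Delta_2$ is a simplicial complex whose $1$-skeleton is a clique (i.e. a complete graph).
   Context: Simplicial complexes are finite and not necessarily pure. A vertex labeling of a complex with $n$ vertices is a bijection of its vertices with $[n]=\{1,\dots,n\}$; $\max f$ is the largest label in a face $f$; the size of a face is its number of vertices. $\Delta$ is skeleton-E-chordal if it has a vertex labeling such that for every two faces $f\neq g$ of $\Delta$ with the same size and the same maximum, every subset $h\subseteq f\cup g$ with $|h|=|f|$ is a face of $\Delta$. $\Delta$ is skeleton-clique-chordal if it has a vertex labeling such that for every two faces $f\ne g$ of $\Delta$ with the same size $\ge 2$ and the same maximum, every $2$-element subset of $f\cup g$ is a face of $\Delta$. A clique of $\Delta$ is a set of vertices any two of which span an edge of $\Delta$. $\Delta$ is subflag if every clique of size $\le \dim\Delta+1$ is a face of $\Delta$. The induced subcomplex on a vertex subset $W$ consists of all faces of $\Delta$ contained in $W$. *)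

theory Defs
  imports Main
begin

text \<open>
  A complex is represented by its set of faces. The empty set is always a face, so the smallest
  complex is \<open>{{}}\<close>, which has no vertices and dimension \<open>-1\<close>. There are no ghost vertices:
  every vertex is itself a face.
\<close>

definition abstract_simplicial_complex :: "'a set set \<Rightarrow> bool" where
  "abstract_simplicial_complex \<Delta> \<longleftrightarrow>
     finite \<Delta> \<and> {} \<in> \<Delta> \<and> (\<forall>f\<in>\<Delta>. finite f) \<and> (\<forall>f\<in>\<Delta>. \<forall>g. g \<subseteq> f \<longrightarrow> g \<in> \<Delta>)"

definition vertices :: "'a set set \<Rightarrow> 'a set" where
  "vertices \<Delta> = {v. {v} \<in> \<Delta>}"

definition complex_dim :: "'a set set \<Rightarrow> int" where
  "complex_dim \<Delta> = int (Max (card ` \<Delta>)) - 1"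

definition vertex_labeling :: "'a set set \<Rightarrow> ('a \<Rightarrow> nat) \<Rightarrow> bool" where
  "vertex_labeling \<Delta> l \<longleftrightarrow> bij_betw l (vertices \<Delta>) {1..card (vertices \<Delta>)}"

text \<open>
  Only meaningful for nonempty faces. In the two definitions below it is never applied to the
  empty face, because two distinct faces of the same size are both nonempty.
\<close>

definition max_label :: "('a \<Rightarrow> nat) \<Rightarrow> 'a set \<Rightarrow> nat" where
  "max_label l f = Max (l ` f)"

definition skeleton_E_chordal :: "'a set set \<Rightarrow> bool" where
  "skeleton_E_chordal \<Delta> \<longleftrightarrow>
     (\<exists>l. vertex_labeling \<Delta> l \<and>
       (\<forall>f\<in>\<Delta>. \<forall>g\<in>\<Delta>. f \<noteq> g \<and> card f = card g \<and> max_label l f = max_label l g \<longrightarrow>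
         (\<forall>h. h \<subseteq> f \<union> g \<and> card h = card f \<longrightarrow> h \<in> \<Delta>)))"

definition skeleton_clique_chordal :: "'a set set \<Rightarrow> bool" where
  "skeleton_clique_chordal \<Delta> \<longleftrightarrow>
     (\<exists>l. vertex_labeling \<Delta> l \<and>
       (\<forall>f\<in>\<Delta>. \<forall>g\<in>\<Delta>. f \<noteq> g \<and> card f = card g \<and> 2 \<le> card f \<and>
           max_label l f = max_label l g \<longrightarrow>
         (\<forall>e. e \<subseteq> f \<union> g \<and> card e = 2 \<longrightarrow> e \<in> \<Delta>)))"

definition clique :: "'a set set \<Rightarrow> 'a set \<Rightarrow> bool" where
  "clique \<Delta> W \<longleftrightarrow> W \<subseteq> vertices \<Delta> \<and> (\<forall>u\<in>W. \<forall>v\<in>W. u \<noteq> v \<longrightarrow> {u, v} \<in> \<Delta>)"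

definition subflag :: "'a set set \<Rightarrow> bool" where
  "subflag \<Delta> \<longleftrightarrow> (\<forall>W. clique \<Delta> W \<and> int (card W) \<le> complex_dim \<Delta> + 1 \<longrightarrow> W \<in> \<Delta>)"

definition induced_on :: "'a set set \<Rightarrow> 'a set \<Rightarrow> 'a set set" where
  "induced_on \<Delta> W = {f \<in> \<Delta>. f \<subseteq> W}"

definition induced_subcomplex :: "'a set set \<Rightarrow> 'a set set \<Rightarrow> bool" where
  "induced_subcomplex \<Gamma> \<Delta> \<longleftrightarrow> (\<exists>W. W \<subseteq> vertices \<Delta> \<and> \<Gamma> = induced_on \<Delta> W)"

definition skeleton :: "nat \<Rightarrow> 'a set set \<Rightarrow> 'a set set" where
  "skeleton k \<Delta> = {f \<in> \<Delta>. card f \<le> k + 1}"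

text \<open>
  A graph is viewed as a complex of dimension at most 1; the graph without vertices counts as
  complete.
\<close>

definition complete_graph :: "'a set set \<Rightarrow> bool" where
  "complete_graph G \<longleftrightarrow> complex_dim G \<le> 1 \<and> clique G (vertices G)"

end

theory Submission
  imports Defs
begin

text \<open>
  All three conditions say that the 1-skeleton has a perfect elimination ordering: already the
  faces of size 2 force the earlier neighbours of each vertex to form a clique, and conversely
  two faces with the same maximum \<open>v\<close> then lie in the clique formed by \<open>v\<close> and its earlier
  neighbours, so that being subflag supplies the remaining faces. For the gluing step,
  a perfect elimination ordering of a graph can be rearranged to start with any prescribed clique,
  because outside a proper clique there is always a simplicial vertex. So one orders the vertices
  of \<open>\<Delta>\<^sub>1\<close> first and then the rest of \<open>\<Delta>\<^sub>2\<close> along an ordering of \<open>\<Delta>\<^sub>2\<close> which starts with the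
  intersection. The splitting in the other direction is the trivial one, \<open>\<Delta> = \<Delta> \<union> {{}}\<close>.
\<close>

section \<open>Simplicial vertices and elimination orderings of graphs\<close>

definition simplicial_vertex :: "('a \<Rightarrow> 'a \<Rightarrow> bool) \<Rightarrow> 'a set \<Rightarrow> 'a \<Rightarrow> bool" where
  "simplicial_vertex E V v \<longleftrightarrow> pairwise E {u \<in> V - {v}. E v u}"

text \<open>The vertices outside \<open>A\<close> can be appended one at a time, each having a
  clique as its earlier neighbours. For \<open>A = {}\<close> this is the existence of a perfect
  elimination ordering of \<open>V\<close>. A general start \<open>A\<close>, on which nothing is
  imposed, lets orderings be concatenated.\<close>

inductive simplicial_extension :: "('a \<Rightarrow> 'a \<Rightarrow> bool) \<Rightarrow> 'a set \<Rightarrow> 'a set \<Rightarrow> bool"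
  for E A where
  base: "simplicial_extension E A A"
| step: "\<lbrakk>simplicial_extension E A V; v \<notin> V; simplicial_vertex E V v\<rbrakk>
    \<Longrightarrow> simplicial_extension E A (insert v V)"

text \<open>The same ordering, written with explicit labels. Labels increase in the order in which
  vertices are added, so elimination in the usual sense starts with the largest label.\<close>

definition elimination_labeling :: "('a \<Rightarrow> 'a \<Rightarrow> bool) \<Rightarrow> 'a set \<Rightarrow> ('a \<Rightarrow> nat) \<Rightarrow> bool" where
  "elimination_labeling E V l \<longleftrightarrow> bij_betw l V {1..card V} \<and>
    (\<forall>v\<in>V. pairwise E {u \<in> V. l u < l v \<and> E v u})"

lemma simplicial_vertex_mono:
  "simplicial_vertex E V v \<Longrightarrow> W \<subseteq> V \<Longrightarrow> simplicial_vertex E W v"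
  unfolding simplicial_vertex_def by (erule pairwise_subset) auto

lemma simplicial_vertex_insert_self:
  "simplicial_vertex E (insert v V) v \<longleftrightarrow> simplicial_vertex E V v"
  unfolding simplicial_vertex_def by simp

lemma simplicial_extension_trans:
  assumes "simplicial_extension E B C" "simplicial_extension E A B"
  shows "simplicial_extension E A C"
  using assms by induction (auto intro: simplicial_extension.intros)

text \<open>Skipping vertices only shrinks the earlier neighbourhoods of the others, and subsets of
  cliques are cliques.\<close>

lemma simplicial_extension_subset:
  assumes "simplicial_extension E {} V" "W \<subseteq> V"
  shows "simplicial_extension E {} W"
  using assms
proof (induction arbitrary: W)
  case base
  then show ?case by (auto intro: simplicial_extension.intros)
next
  case (step V v)
  have *: "simplicial_extension E {} (W - {v})"
    using step.prems by (intro step.IH) auto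
  show ?case
  proof (cases "v \<in> W")
    case True
    have "simplicial_extension E {} (insert v (W - {v}))"
      using * step.hyps step.prems
      by (intro simplicial_extension.step simplicial_vertex_mono[OF step.hyps(3)]) auto
    with True show ?thesis by (simp add: insert_absorb)
  qed (use * in simp)
qed

section \<open>Starting an ordering with a prescribed clique\<close>

lemma simplicial_extension_finite:
  "simplicial_extension E {} V \<Longrightarrow> finite V"
  by (induction rule: simplicial_extension.induct) auto

text \<open>A form of Dirac's theorem on simplicial vertices of chordal graphs. The last vertex
  \<open>v\<close> of the ordering works itself unless it lies in \<open>K\<close>; in that case the
  induction hypothesis is applied with the neighbourhood of \<open>v\<close> in place of
  \<open>K\<close>, which is why \<open>K\<close> must be arbitrary.\<close>

lemma simplicial_vertex_outside_clique:
  assumes "simplicial_extension E {} V" "symp E" "K \<subset> V" "pairwise E K"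
  shows "\<exists>v\<in>V - K. simplicial_vertex E V v"
  using assms
proof (induction arbitrary: K)
  case base
  then show ?case by auto
next
  case (step V v)
  note sym = sympD[OF \<open>symp E\<close>]
  show ?case
  proof (cases "v \<in> K")
    case False
    with step.hyps(3) show ?thesis
      by (intro bexI[of _ v]) (auto simp: simplicial_vertex_insert_self)
  next
    case True
    let ?N = "{u \<in> V. E v u}"
    have N: "pairwise E ?N"
      using step.hyps(2,3) unfolding simplicial_vertex_def by (auto simp: pairwise_def)
    show ?thesis
    proof (cases "?N = V")
      case True
      \<comment> \<open>Here \<open>v\<close> is adjacent to everything, so the whole graph is
        complete and every vertex is simplicial.\<close>
      then have "pairwise E (insert v V)"
        using N sym by (fastforce simp: pairwise_insert)
      moreover obtain w where "w \<in> insert v V - K"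
        using step.prems by blast
      ultimately show ?thesis
        unfolding simplicial_vertex_def by (intro bexI[of _ w]) (auto simp: pairwise_def)
    next
      case False
      \<comment> \<open>As \<open>w\<close> is not adjacent to \<open>v\<close>, adding
        \<open>v\<close> leaves its neighbourhood unchanged, and \<open>w\<close> cannot belong to
        the clique \<open>K\<close>, which contains \<open>v\<close>.\<close>
      then obtain w where w: "w \<in> V - ?N" "simplicial_vertex E V w"
        using step.IH[of ?N] N \<open>symp E\<close> by blast
      then have "\<not> E w v" using sym by blast
      then have "simplicial_vertex E (insert v V) w"
        using w(2) unfolding simplicial_vertex_def by (rule_tac pairwise_subset) auto
      moreover have "w \<notin> K"
        using w step.prems(3) step.hyps(2) \<open>v \<in> K\<close> by (auto simp: pairwise_def)
      ultimately show ?thesis using w by auto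
    qed
  qed
qed

text \<open>The ordering is built from its end: a simplicial vertex outside \<open>K\<close> is put
  last, and what remains is again orderable because orderability passes to subsets.\<close>

lemma simplicial_extension_from_clique:
  assumes "simplicial_extension E {} V" "symp E" "K \<subseteq> V" "pairwise E K"
  shows "simplicial_extension E K V"
  using assms
proof (induction "card (V - K)" arbitrary: V rule: less_induct)
  case less
  show ?case
  proof (cases "K = V")
    case True
    then show ?thesis by (auto intro: simplicial_extension.intros)
  next
    case False
    then obtain v where v: "v \<in> V - K" "simplicial_vertex E V v"
      using simplicial_vertex_outside_clique less.prems by (metis psubsetI)
    have "card (V - {v} - K) < card (V - K)"
      using v simplicial_extension_finite[OF less.prems(1)] by (intro psubset_card_mono) auto
    moreover have "simplicial_extension E {} (V - {v})"
      using less.prems(1) by (rule simplicial_extension_subset) auto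
    ultimately have "simplicial_extension E K (V - {v})"
      using less.hyps[of "V - {v}"] less.prems v by blast
    then have "simplicial_extension E K (insert v (V - {v}))"
      by (rule simplicial_extension.step) (use v in \<open>auto intro: simplicial_vertex_mono\<close>)
    with v show ?thesis by (simp add: insert_absorb)
  qed
qed

section \<open>Gluing two orderings along their intersection\<close>

lemma simplicial_extension_union:
  assumes "simplicial_extension E (A \<inter> B) C" "C \<subseteq> B"
    and "\<And>a b. a \<in> A - B \<Longrightarrow> b \<in> B - A \<Longrightarrow> \<not> E b a"
  shows "simplicial_extension E A (A \<union> C)"
  using assms
proof induction
  case base
  then show ?case by (simp add: Un_absorb2 simplicial_extension.base)
next
  case (step V v)
  have IH: "simplicial_extension E A (A \<union> V)" using step by blast
  show ?case
  proof (cases "v \<in> A")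
    case True
    then show ?thesis using IH by (simp add: insert_absorb)
  next
    case False
    \<comment> \<open>Since \<open>v\<close> lies in \<open>B - A\<close>, it has no neighbour in
      \<open>A - B\<close>, and \<open>A \<inter> B\<close> is already part of \<open>V\<close>.
      Hence placing all of \<open>A\<close> in front gives \<open>v\<close> no new earlier
      neighbours.\<close>
    have sub: "A \<inter> B \<subseteq> V" using step.hyps(1) by induction auto
    have "{u \<in> A \<union> V - {v}. E v u} \<subseteq> {u \<in> V - {v}. E v u}"
      using step.prems False sub by auto
    then have "simplicial_vertex E (A \<union> V) v"
      using step.hyps(3) unfolding simplicial_vertex_def by (rule_tac pairwise_subset)
    then have "simplicial_extension E A (insert v (A \<union> V))"
      using IH False step.hyps(2) by (intro simplicial_extension.step) auto
    then show ?thesis by simp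
  qed
qed

lemma simplicial_extension_glue:
  assumes "simplicial_extension E {} A" "simplicial_extension E {} B" "symp E"
    and "pairwise E (A \<inter> B)"
    and "\<And>a b. a \<in> A - B \<Longrightarrow> b \<in> B - A \<Longrightarrow> \<not> E b a"
  shows "simplicial_extension E {} (A \<union> B)"
proof -
  have "simplicial_extension E (A \<inter> B) B"
    by (rule simplicial_extension_from_clique) (use assms in auto)
  then have "simplicial_extension E A (A \<union> B)"
    by (rule simplicial_extension_union) (use assms(5) in auto)
  then show ?thesis using assms(1) by (rule simplicial_extension_trans)
qed

section \<open>Orderings and labelings\<close>

lemma simplicial_extension_of_labeling:
  assumes "elimination_labeling E V l"
  shows "simplicial_extension E {} V"
proof -
  have bij: "bij_betw l V {1..card V}"
    and pw: "\<And>v. v \<in> V \<Longrightarrow> pairwise E {u \<in> V. l u < l v \<and> E v u}"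
    using assms unfolding elimination_labeling_def by auto
  \<comment> \<open>Induction over the initial segments of the labeling. The segment for
    \<open>0\<close> is empty because labels start at 1; injectivity makes each later segment larger
    by exactly one vertex.\<close>
  have "simplicial_extension E {} {v \<in> V. l v \<le> n}" if "n \<le> card V" for n
    using that
  proof (induction n)
    case 0
    have "{v \<in> V. l v \<le> 0} = {}" using bij by (force simp: bij_betw_def)
    then show ?case by (metis simplicial_extension.base)
  next
    case (Suc n)
    have "Suc n \<in> l ` V" using bij Suc.prems by (auto simp: bij_betw_def)
    then obtain v where v: "v \<in> V" "l v = Suc n" by auto
    have "{u \<in> V. l u \<le> Suc n} = insert v {u \<in> V. l u \<le> n}"
      using v bij by (auto simp: bij_betw_def inj_on_def le_Suc_eq)
    moreover have "simplicial_vertex E {u \<in> V. l u \<le> n} v"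
      unfolding simplicial_vertex_def
      by (rule pairwise_subset[OF pw[OF v(1)]]) (use v in auto)
    ultimately show ?case
      using Suc v by (auto intro!: simplicial_extension.step)
  qed
  from this[of "card V"] have "simplicial_extension E {} {v \<in> V. l v \<le> card V}" by simp
  moreover have "{v \<in> V. l v \<le> card V} = V" using bij by (auto simp: bij_betw_def)
  ultimately show ?thesis by simp
qed

lemma labeling_of_simplicial_extension:
  assumes "simplicial_extension E {} V"
  shows "\<exists>l. elimination_labeling E V l"
  using assms
proof induction
  case base
  then show ?case by (simp add: elimination_labeling_def bij_betw_def)
next
  case (step V v)
  then obtain l where l: "bij_betw l V {1..card V}"
    "\<And>w. w \<in> V \<Longrightarrow> pairwise E {u \<in> V. l u < l w \<and> E w u}"
    unfolding elimination_labeling_def by auto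
  have fin: "finite V" by (rule simplicial_extension_finite[OF step.hyps(1)])
  \<comment> \<open>The new vertex gets a label above all others, so it never counts as an earlier
    neighbour of an old vertex.\<close>
  let ?l = "l(v := Suc (card V))"
  have card: "card (insert v V) = Suc (card V)" using step.hyps fin by simp
  have le: "l u \<le> card V" if "u \<in> V" for u using l(1) that by (auto simp: bij_betw_def)
  have "bij_betw ?l V {1..card V}"
    using l(1) step.hyps(2) by (subst bij_betw_cong[where g = l]) auto
  then have "bij_betw ?l (V \<union> {v}) ({1..card V} \<union> {Suc (card V)})"
    by (rule bij_betw_combine) auto
  moreover have "{1..card V} \<union> {Suc (card V)} = {1..Suc (card V)}" by auto
  ultimately have "bij_betw ?l (insert v V) {1..card (insert v V)}"
    using card by (metis Un_insert_right sup_bot_right)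
  moreover have "pairwise E {u \<in> insert v V. ?l u < ?l w \<and> E w u}" if "w \<in> insert v V" for w
  proof (cases "w = v")
    case True
    have "{u \<in> insert v V. ?l u < ?l w \<and> E w u} \<subseteq> {u \<in> V - {v}. E v u}"
      using True by auto
    then show ?thesis using step.hyps(3) unfolding simplicial_vertex_def
      by (rule_tac pairwise_subset)
  next
    case False
    then have w: "w \<in> V" using that by simp
    have "{u \<in> insert v V. ?l u < ?l w \<and> E w u} \<subseteq> {u \<in> V. l u < l w \<and> E w u}"
      using False le[OF w] by (auto split: if_splits)
    then show ?thesis by (rule pairwise_subset[OF l(2)[OF w]])
  qed
  ultimately show ?case unfolding elimination_labeling_def by blast
qed

section \<open>Chordality of a complex and its edge graph\<close>

abbreviation adjacent :: "'a set set \<Rightarrow> 'a \<Rightarrow> 'a \<Rightarrow> bool" where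
  "adjacent \<Delta> u v \<equiv> {u, v} \<in> \<Delta>"

lemma symp_adjacent: "symp (adjacent \<Delta>)"
  by (rule sympI) (simp add: insert_commute)

lemma clique_iff_pairwise:
  "clique \<Delta> W \<longleftrightarrow> W \<subseteq> vertices \<Delta> \<and> pairwise (adjacent \<Delta>) W"
  by (simp add: clique_def pairwise_def)

lemma complex_finite: "abstract_simplicial_complex \<Delta> \<Longrightarrow> finite \<Delta>"
  and face_finite: "abstract_simplicial_complex \<Delta> \<Longrightarrow> f \<in> \<Delta> \<Longrightarrow> finite f"
  and face_subset: "abstract_simplicial_complex \<Delta> \<Longrightarrow> f \<in> \<Delta> \<Longrightarrow> g \<subseteq> f \<Longrightarrow> g \<in> \<Delta>"
  by (simp_all add: abstract_simplicial_complex_def)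

lemma face_subset_vertices:
  assumes "abstract_simplicial_complex \<Delta>" "f \<in> \<Delta>"
  shows "f \<subseteq> vertices \<Delta>"
  using face_subset[OF assms] by (simp add: vertices_def subset_iff)

text \<open>A pair inside \<open>f \<union> g\<close> can be enlarged within
  \<open>f \<union> g\<close> to a set of size \<open>card f \<ge> 2\<close>. That set is a face,
  hence so is the pair.\<close>

lemma skeleton_E_chordal_imp_clique_chordal:
  assumes "abstract_simplicial_complex \<Delta>" "skeleton_E_chordal \<Delta>"
  shows "skeleton_clique_chordal \<Delta>"
proof -
  obtain l where l: "vertex_labeling \<Delta> l"
    and E: "\<forall>f\<in>\<Delta>. \<forall>g\<in>\<Delta>. f \<noteq> g \<and> card f = card g \<and> max_label l f = max_label l g \<longrightarrow>
      (\<forall>h. h \<subseteq> f \<union> g \<and> card h = card f \<longrightarrow> h \<in> \<Delta>)"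
    using assms(2)[unfolded skeleton_E_chordal_def] that by (elim exE conjE)
  show ?thesis
    unfolding skeleton_clique_chordal_def
  proof (intro exI[of _ l] conjI ballI allI impI l)
    fix f g e
    assume fg: "f \<in> \<Delta>" "g \<in> \<Delta>" "f \<noteq> g \<and> card f = card g \<and> 2 \<le> card f \<and> max_label l f = max_label l g"
      and e: "e \<subseteq> f \<union> g \<and> card e = 2"
    have fin: "finite (f \<union> g)"
      using face_finite[OF assms(1) fg(1)] face_finite[OF assms(1) fg(2)] by simp
    then have "card f \<le> card (f \<union> g)" by (intro card_mono) auto
    then obtain h where h: "e \<subseteq> h" "h \<subseteq> f \<union> g" "card h = card f"
      using exists_subset_between[of e "card f" "f \<union> g"] fin e fg(3) by metis
    have "h \<in> \<Delta>"
      by (rule E[rule_format, OF fg(1,2)]) (use fg h in simp_all)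
    then show "e \<in> \<Delta>" using h(1) by (rule face_subset[OF assms(1)])
  qed
qed

lemma max_label_pair: "max_label l {u, v} = max (l u) (l v)"
  by (simp add: max_label_def)

lemma skeleton_clique_chordal_imp_elimination_labeling:
  assumes "skeleton_clique_chordal \<Delta>"
  shows "\<exists>l. elimination_labeling (adjacent \<Delta>) (vertices \<Delta>) l"
proof -
  obtain l where l: "vertex_labeling \<Delta> l"
    and C: "\<forall>f\<in>\<Delta>. \<forall>g\<in>\<Delta>. f \<noteq> g \<and> card f = card g \<and> 2 \<le> card f \<and>
        max_label l f = max_label l g \<longrightarrow>
      (\<forall>e. e \<subseteq> f \<union> g \<and> card e = 2 \<longrightarrow> e \<in> \<Delta>)"
    using assms[unfolded skeleton_clique_chordal_def] that by (elim exE conjE)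
  have "{a, b} \<in> \<Delta>"
    if "l a < l v" "{v, a} \<in> \<Delta>" "l b < l v" "{v, b} \<in> \<Delta>" "a \<noteq> b" for v a b
  \<comment> \<open>Both edges \<open>{v, a}\<close> and \<open>{v, b}\<close> have size 2 and
    maximum \<open>l v\<close>, and \<open>{a, b}\<close> lies in their union.\<close>
  proof (rule C[rule_format, OF that(2,4)])
    have "v \<noteq> a" "v \<noteq> b" using that by auto
    then show "{v, a} \<noteq> {v, b} \<and> card {v, a} = card {v, b} \<and> 2 \<le> card {v, a} \<and>
        max_label l {v, a} = max_label l {v, b}"
      using that by (simp add: max_label_pair doubleton_eq_iff)
    show "{a, b} \<subseteq> {v, a} \<union> {v, b} \<and> card {a, b} = 2" using that by simp
  qed
  then show ?thesis
    using l unfolding elimination_labeling_def vertex_labeling_def pairwise_def by blast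
qed

lemma elimination_labeling_imp_skeleton_E_chordal:
  assumes \<Delta>: "abstract_simplicial_complex \<Delta>" and "subflag \<Delta>"
    and l: "elimination_labeling (adjacent \<Delta>) (vertices \<Delta>) l"
  shows "skeleton_E_chordal \<Delta>"
proof -
  have bij: "bij_betw l (vertices \<Delta>) {1..card (vertices \<Delta>)}"
    and pw: "\<And>v. v \<in> vertices \<Delta> \<Longrightarrow>
      pairwise (adjacent \<Delta>) {u \<in> vertices \<Delta>. l u < l v \<and> {v, u} \<in> \<Delta>}"
    using l unfolding elimination_labeling_def by auto
  have inj: "inj_on l (vertices \<Delta>)" using bij by (simp add: bij_betw_def)
  \<comment> \<open>A nonempty face consists of its vertex of largest label and of earlier
    neighbours of that vertex.\<close>
  have top: "\<exists>v\<in>f. l v = max_label l f \<and>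
      f \<subseteq> insert v {u \<in> vertices \<Delta>. l u < l v \<and> {v, u} \<in> \<Delta>}"
    if f: "f \<in> \<Delta>" "f \<noteq> {}" for f
  proof -
    have fin: "finite (l ` f)" using f face_finite[OF \<Delta>] by auto
    then have "max_label l f \<in> l ` f" using f unfolding max_label_def by (intro Max_in) auto
    then obtain v where v: "v \<in> f" "l v = max_label l f" by auto
    have "u \<in> vertices \<Delta> \<and> l u < l v \<and> {v, u} \<in> \<Delta>" if "u \<in> f" "u \<noteq> v" for u
    proof -
      have "l u \<le> l v" using v that fin by (auto simp: max_label_def)
      moreover have uv: "u \<in> vertices \<Delta>" "v \<in> vertices \<Delta>"
        using that v face_subset_vertices[OF \<Delta> f(1)] by auto
      then have "l u \<noteq> l v" using inj that by (auto simp: inj_on_def)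
      ultimately show ?thesis using uv v that face_subset[OF \<Delta> f(1), of "{v, u}"] by auto
    qed
    then show ?thesis using v by blast
  qed
  show ?thesis
    unfolding skeleton_E_chordal_def vertex_labeling_def
  proof (intro exI[of _ l] conjI ballI allI impI bij)
    fix f g h
    assume fg: "f \<in> \<Delta>" "g \<in> \<Delta>" "f \<noteq> g \<and> card f = card g \<and> max_label l f = max_label l g"
      and h: "h \<subseteq> f \<union> g \<and> card h = card f"
    have "finite f" "finite g" using fg(1,2) face_finite[OF \<Delta>] by simp_all
    \<comment> \<open>If one of the two faces were empty, equal cardinality would make the other
      empty too, against \<open>f \<noteq> g\<close>.\<close>
    then have "f \<noteq> {}" "g \<noteq> {}" using fg(3) by auto
    then obtain v w where v: "v \<in> f" "l v = max_label l f"
        "f \<subseteq> insert v {u \<in> vertices \<Delta>. l u < l v \<and> {v, u} \<in> \<Delta>}"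
      and w: "w \<in> g" "l w = max_label l g"
        "g \<subseteq> insert w {u \<in> vertices \<Delta>. l u < l w \<and> {w, u} \<in> \<Delta>}"
      using top fg by meson
    have vV: "v \<in> vertices \<Delta>" and "w \<in> vertices \<Delta>"
      using v w fg face_subset_vertices[OF \<Delta>] by auto
    \<comment> \<open>Equal maxima mean the same top vertex, since labels are injective on
      vertices.\<close>
    then have "w = v" using v w fg inj by (auto simp: inj_on_def)
    let ?N = "insert v {u \<in> vertices \<Delta>. l u < l v \<and> {v, u} \<in> \<Delta>}"
    have "pairwise (adjacent \<Delta>) ?N"
      using pw[OF vV] by (auto simp: pairwise_insert insert_commute)
    moreover have "h \<subseteq> ?N" using h v(3) w(3) \<open>w = v\<close> by blast
    ultimately have "clique \<Delta> h"
      using vV by (auto simp: clique_iff_pairwise intro: pairwise_subset)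
    \<comment> \<open>\<open>complex_dim \<Delta> + 1\<close> is the largest face size, so a set as
      large as the face \<open>f\<close> meets the size bound in \<open>subflag\<close>.\<close>
    moreover have "card f \<le> Max (card ` \<Delta>)"
      using complex_finite[OF \<Delta>] fg by (intro Max_ge) auto
    then have "int (card h) \<le> complex_dim \<Delta> + 1"
      using h unfolding complex_dim_def by simp
    ultimately show "h \<in> \<Delta>" using assms(2) unfolding subflag_def by blast
  qed
qed

section \<open>Splittings into induced subcomplexes\<close>

lemma abstract_simplicial_complex_induced_on:
  "abstract_simplicial_complex \<Delta> \<Longrightarrow> abstract_simplicial_complex (induced_on \<Delta> W)"
  unfolding abstract_simplicial_complex_def induced_on_def by auto

lemma vertices_induced_on: "vertices (induced_on \<Delta> W) = vertices \<Delta> \<inter> W"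
  unfolding vertices_def induced_on_def by auto

text \<open>An ordering of \<open>W\<close> depends only on edges inside \<open>W\<close>, and for
  these the induced subcomplex and \<open>\<Delta>\<close> agree.\<close>

lemma simplicial_extension_induced_on:
  assumes "abstract_simplicial_complex \<Delta>" "W \<subseteq> vertices \<Delta>"
    "skeleton_E_chordal (induced_on \<Delta> W)"
  shows "simplicial_extension (adjacent \<Delta>) {} W"
proof -
  have "vertices (induced_on \<Delta> W) = W" using assms(2) by (auto simp: vertices_induced_on)
  then obtain l where "elimination_labeling (adjacent (induced_on \<Delta> W)) W l"
    using skeleton_clique_chordal_imp_elimination_labeling
      skeleton_E_chordal_imp_clique_chordal[OF abstract_simplicial_complex_induced_on assms(3)]
      assms(1) by metis
  then have "elimination_labeling (adjacent \<Delta>) W l"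
    unfolding elimination_labeling_def by (auto simp: induced_on_def pairwise_def)
  then show ?thesis by (rule simplicial_extension_of_labeling)
qed

lemma skeleton_E_chordal_union:
  assumes \<Delta>: "abstract_simplicial_complex \<Delta>" "subflag \<Delta>"
    and union: "\<Delta> = \<Delta>\<^sub>1 \<union> \<Delta>\<^sub>2"
    and 1: "induced_subcomplex \<Delta>\<^sub>1 \<Delta>" "skeleton_E_chordal \<Delta>\<^sub>1"
    and 2: "induced_subcomplex \<Delta>\<^sub>2 \<Delta>" "skeleton_E_chordal \<Delta>\<^sub>2"
    and clique: "complete_graph (skeleton 1 (\<Delta>\<^sub>1 \<inter> \<Delta>\<^sub>2))"
  shows "skeleton_E_chordal \<Delta>"
proof -
  obtain V W where V: "V \<subseteq> vertices \<Delta>" "\<Delta>\<^sub>1 = induced_on \<Delta> V"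
    and W: "W \<subseteq> vertices \<Delta>" "\<Delta>\<^sub>2 = induced_on \<Delta> W"
    using 1(1) 2(1) unfolding induced_subcomplex_def by blast
  \<comment> \<open>For singletons this says that \<open>V\<close> and \<open>W\<close> cover the
    vertices; for pairs it rules out edges between \<open>V - W\<close> and \<open>W - V\<close>, as
    gluing requires.\<close>
  have mem: "f \<subseteq> V \<or> f \<subseteq> W" if "f \<in> \<Delta>" for f
  proof -
    have "f \<in> \<Delta>\<^sub>1 \<or> f \<in> \<Delta>\<^sub>2" using that by (subst (asm) union) simp
    then show ?thesis unfolding V(2) W(2) induced_on_def by auto
  qed
  have VW: "vertices \<Delta> = V \<union> W"
    using V(1) W(1) mem by (fastforce simp: vertices_def)
  have "vertices (skeleton 1 (\<Delta>\<^sub>1 \<inter> \<Delta>\<^sub>2)) = V \<inter> W"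
    using V(1) W(1) unfolding V(2) W(2) by (auto simp: vertices_def skeleton_def induced_on_def)
  moreover have "skeleton 1 (\<Delta>\<^sub>1 \<inter> \<Delta>\<^sub>2) \<subseteq> \<Delta>"
    unfolding V(2) W(2) by (auto simp: skeleton_def induced_on_def)
  ultimately have pw: "pairwise (adjacent \<Delta>) (V \<inter> W)"
    using clique unfolding complete_graph_def clique_iff_pairwise by (auto simp: pairwise_def)
  have "simplicial_extension (adjacent \<Delta>) {} (V \<union> W)"
  proof (rule simplicial_extension_glue)
    show "simplicial_extension (adjacent \<Delta>) {} V" "simplicial_extension (adjacent \<Delta>) {} W"
      using simplicial_extension_induced_on[OF \<Delta>(1)] 1(2) 2(2) V W by simp_all
    show "{b, a} \<notin> \<Delta>" if "a \<in> V - W" "b \<in> W - V" for a b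
      using mem[of "{b, a}"] that by auto
  qed (use pw in \<open>simp_all add: symp_adjacent\<close>)
  then obtain l where "elimination_labeling (adjacent \<Delta>) (vertices \<Delta>) l"
    using labeling_of_simplicial_extension VW by metis
  then show ?thesis using \<Delta> elimination_labeling_imp_skeleton_E_chordal by blast
qed

lemma trivial_splitting:
  assumes \<Delta>: "abstract_simplicial_complex \<Delta>"
  shows "\<Delta> = \<Delta> \<union> {{}}" "induced_subcomplex \<Delta> \<Delta>" "induced_subcomplex {{}} \<Delta>"
    "skeleton_E_chordal {{}}" "abstract_simplicial_complex (\<Delta> \<inter> {{}})"
    "complete_graph (skeleton 1 (\<Delta> \<inter> {{}}))"
proof -
  have empty: "{} \<in> \<Delta>" using \<Delta> by (simp add: abstract_simplicial_complex_def)
  then show "\<Delta> = \<Delta> \<union> {{}}" by auto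
  show "induced_subcomplex \<Delta> \<Delta>"
    unfolding induced_subcomplex_def induced_on_def
    using face_subset_vertices[OF \<Delta>] by (intro exI[of _ "vertices \<Delta>"]) auto
  show "induced_subcomplex {{}} \<Delta>"
    unfolding induced_subcomplex_def induced_on_def
    using empty by (intro exI[of _ "{}"]) auto
  \<comment> \<open>There are no vertices to label, and a single face leaves no two distinct faces
    to compare.\<close>
  show "skeleton_E_chordal {{}}"
    unfolding skeleton_E_chordal_def vertex_labeling_def vertices_def by (simp add: bij_betw_def)
  have int: "\<Delta> \<inter> {{}} = {{}}" using empty by auto
  show "abstract_simplicial_complex (\<Delta> \<inter> {{}})"
    unfolding int abstract_simplicial_complex_def by auto
  have skel: "skeleton 1 {{}} = {{}}" unfolding skeleton_def by auto
  \<comment> \<open>The complex \<open>{{}}\<close> has dimension -1 and no vertices, so it counts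
    as a complete graph.\<close>
  show "complete_graph (skeleton 1 (\<Delta> \<inter> {{}}))"
    unfolding int skel by (simp add: complete_graph_def complex_dim_def clique_def vertices_def)
qed

theorem theorem2:
  fixes \<Delta> :: "'a set set"
  assumes "abstract_simplicial_complex \<Delta>"
    and "subflag \<Delta>"
  shows "(skeleton_E_chordal \<Delta> \<longleftrightarrow> skeleton_clique_chordal \<Delta>) \<and>
    (skeleton_clique_chordal \<Delta> \<longleftrightarrow>
      (\<exists>\<Delta>\<^sub>1 \<Delta>\<^sub>2. \<Delta> = \<Delta>\<^sub>1 \<union> \<Delta>\<^sub>2 \<and>
        induced_subcomplex \<Delta>\<^sub>1 \<Delta> \<and> skeleton_E_chordal \<Delta>\<^sub>1 \<and>
        induced_subcomplex \<Delta>\<^sub>2 \<Delta> \<and> skeleton_E_chordal \<Delta>\<^sub>2 \<and>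
        abstract_simplicial_complex (\<Delta>\<^sub>1 \<inter> \<Delta>\<^sub>2) \<and>
        complete_graph (skeleton 1 (\<Delta>\<^sub>1 \<inter> \<Delta>\<^sub>2))))"
proof -
  \<comment> \<open>The cycle of implications closes through elimination labelings;
    \<open>subflag\<close> enters in the return from a labeling to
    \<open>skeleton_E_chordal\<close>.\<close>
  have ab: "skeleton_E_chordal \<Delta> \<longleftrightarrow> skeleton_clique_chordal \<Delta>"
    using assms skeleton_E_chordal_imp_clique_chordal
      skeleton_clique_chordal_imp_elimination_labeling
      elimination_labeling_imp_skeleton_E_chordal by blast
  show ?thesis
    unfolding ab[symmetric]
    using trivial_splitting[OF assms(1)] skeleton_E_chordal_union[OF assms] by blast
qed

end
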